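(* Let $p$ be a prime number, let $S=\{p\}$, and let $\mathcal{G}$ be the $S$-unit graph. For every integer $n\ge 3$, there exists a nondegenerate induced cycle of $\mathcal{G}$ of length $n$ if and only if $n\equiv 2 \pmod{p-1}$.
   Context: For a finite nonempty set $S$ of primes, $\mathbb{Z}_S$ is the ring of rational numbers whose denominators (in lowest terms) are not divisible by any prime outside $S$, and $\mathbb{Z}_S^*$ is its group of invertible elements, called $S$-units (an $S$-unit may be positive or negative). The $S$-unit graph $\mathcal{G}$ has vertex set $\mathbb{Q}$, and $x,y\in\mathbb{Q}$ are joined by an edge if and only if $x-y\in\mathbb{Z}_S^*$. A cycle of length $n\ge 3$ of $\mathcal{G}$, written $a_1\to a_2\to\cdots\to a_n\to a_1$, consists of distinct $a_1,\dots,a_n\in\mathbb{Q}$ such that $a_{i+1}-a_i$ ($1\le i\le n-1$) and $a_1-a_n$ are $S$-units. It is an induced cycle if, for distinct $i,j\in\{1,\dots,n\}$, $a_j-a_i$ is an $S$-unit if and only if $j\in\{i+1,i-1\}$ or $\{i,j\}=\{1,n\}$. Given a cycle, put $u_i=a_{i+1}-a_i$ for $i=1,\dots,n-1$ and $u_n=a_1-a_n$, so that $u_1+\cdots+u_n=0$. The cycle is degenerate if there exist an integer $l$ with $0<l<n$ and indices $1\le i_1<\cdots<i_l\le n$ such that $u_{i_1}+\cdots+u_{i_l}=0$; otherwise it is nondegenerate. *)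

theory Defs
  imports Complex_Main "HOL-Computational_Algebra.Primes" "HOL-Number_Theory.Cong"
begin

definition S_integers :: "nat set \<Rightarrow> rat set" where
  "S_integers S =
     {x. \<forall>q::nat. prime q \<and> int q dvd snd (quotient_of x) \<longrightarrow> q \<in> S}"

definition S_units :: "nat set \<Rightarrow> rat set" where
  "S_units S = {x \<in> S_integers S. \<exists>y \<in> S_integers S. x * y = 1}"

text \<open>The graph has vertex set all of \<^typ>\<open>rat\<close>, so it is given by its adjacency relation.\<close>

definition S_unit_adj :: "nat set \<Rightarrow> rat \<Rightarrow> rat \<Rightarrow> bool" where
  "S_unit_adj S x y \<longleftrightarrow> x - y \<in> S_units S"

text \<open>A cycle of length \<open>n\<close> is a family \<open>a\<close> indexed by \<open>{1..n}\<close>; the values of \<open>a\<close> outside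
  this range are irrelevant.\<close>

definition is_cycle :: "nat set \<Rightarrow> nat \<Rightarrow> (nat \<Rightarrow> rat) \<Rightarrow> bool" where
  "is_cycle S n a \<longleftrightarrow>
     n \<ge> 3 \<and> inj_on a {1..n} \<and>
     (\<forall>i. 1 \<le> i \<and> i < n \<longrightarrow> S_unit_adj S (a (i + 1)) (a i)) \<and>
     S_unit_adj S (a 1) (a n)"

definition is_induced_cycle :: "nat set \<Rightarrow> nat \<Rightarrow> (nat \<Rightarrow> rat) \<Rightarrow> bool" where
  "is_induced_cycle S n a \<longleftrightarrow>
     is_cycle S n a \<and>
     (\<forall>i\<in>{1..n}. \<forall>j\<in>{1..n}. i \<noteq> j \<longrightarrow>
        (S_unit_adj S (a j) (a i) \<longleftrightarrow> j = i + 1 \<or> i = j + 1 \<or> {i, j} = {1, n}))"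

definition cycle_step :: "nat \<Rightarrow> (nat \<Rightarrow> rat) \<Rightarrow> nat \<Rightarrow> rat" where
  "cycle_step n a i = (if i = n then a 1 - a n else a (i + 1) - a i)"

text \<open>The index set \<open>I\<close> is \<open>{i\<^sub>1 < \<dots> < i\<^sub>l}\<close> with \<open>l = card I\<close>.\<close>

definition degenerate_cycle :: "nat \<Rightarrow> (nat \<Rightarrow> rat) \<Rightarrow> bool" where
  "degenerate_cycle n a \<longleftrightarrow>
     (\<exists>I. I \<subseteq> {1..n} \<and> 0 < card I \<and> card I < n \<and> (\<Sum>i\<in>I. cycle_step n a i) = 0)"

end

theory Submission imports Defs begin

text \<open>
  The \<open>{p}\<close>-units are the numbers \<open>\<plusminus>p^k\<close>. In a minimal vanishing sum of more than two of them,
  the terms of least \<open>p\<close>-adic valuation all have the same sign, so their number is a multiple of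
  \<open>p\<close>, and merging \<open>p\<close> of them into one term gives a minimal vanishing sum with \<open>p - 1\<close> fewer
  terms. Iterating ends with two terms, whence \<open>n \<equiv> 2 (mod p - 1)\<close>; inducedness plays no role.
  Conversely, for \<open>n = k (p - 1) + 2\<close> take the numbers \<open>d p^q \<le> p^k\<close> with \<open>1 \<le> d < p\<close> in increasing
  order, followed by \<open>p^k + 1\<close>. The sequence increases, so the cycle is nondegenerate, and
  comparing base-\<open>p\<close> digits shows that there are no chords.
\<close>

section \<open>The units of the ring of \<open>{p}\<close>-integers\<close>

lemma snd_quotient_of_dvd:
  assumes "x * of_int b = of_int c"
  shows "snd (quotient_of x) dvd b"
proof -
  obtain m d where q: "quotient_of x = (m, d)" by (cases "quotient_of x")
  have d: "d > 0" and x: "x = of_int m / of_int d" and co: "coprime m d"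
    using quotient_of_denom_pos[OF q] quotient_of_div[OF q] quotient_of_coprime[OF q] by auto
  have "of_int (m * b) = (of_int (c * d) :: rat)"
    using assms d unfolding x by (simp add: field_simps)
  hence "m * b = c * d" by (simp only: of_int_eq_iff)
  hence "d dvd m * b" by simp
  with co have "d dvd b" by (simp add: coprime_commute coprime_dvd_mult_right_iff)
  thus ?thesis by (simp add: q)
qed

lemma prime_power_if_only_prime_divisor:
  fixes m p :: nat
  assumes "m > 0" and "\<And>q. prime q \<Longrightarrow> q dvd m \<Longrightarrow> q = p"
  shows "\<exists>k. m = p ^ k"
proof -
  have "prime_factorization m = replicate_mset (size (prime_factorization m)) p"
    using assms by (intro set_mset_subset_singletonD) (auto simp: in_prime_factors_iff)
  hence "prod_mset (prime_factorization m) = p ^ size (prime_factorization m)"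
    by (metis prod_mset_replicate_mset)
  thus ?thesis using assms(1) by (auto simp: prod_mset_prime_factorization_nat)
qed

lemma S_integers_singletonI:
  assumes "prime p" and "x * of_nat p ^ m = of_int c"
  shows "x \<in> S_integers {p}"
proof -
  have "x * of_int (int p ^ m) = of_int c" using assms(2) by simp
  from snd_quotient_of_dvd[OF this] have *: "snd (quotient_of x) dvd int p ^ m" .
  {
    fix q assume "prime q" "int q dvd snd (quotient_of x)"
    hence "int q dvd int p ^ m" using * dvd_trans by blast
    hence "q dvd p ^ m" by (simp flip: of_nat_power)
    hence "q = p" using assms(1) \<open>prime q\<close> by (metis prime_dvd_power primes_dvd_imp_eq)
  }
  thus ?thesis by (auto simp: S_integers_def)
qed

text \<open>Write \<open>x\<close> as a/b and its inverse as c/d in lowest terms, so that a * c = b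
  * d. Every prime factor of a divides b or d and is therefore \<open>p\<close>; hence b and |a| are
  both powers of \<open>p\<close>.\<close>

lemma S_units_singleton_iff:
  assumes p: "prime p"
  shows "x \<in> S_units {p} \<longleftrightarrow> (\<exists>k. \<bar>x\<bar> = of_nat p powi k)"
proof
  assume "x \<in> S_units {p}"
  then obtain y where x: "x \<in> S_integers {p}" and y: "y \<in> S_integers {p}" and xy: "x * y = 1"
    by (auto simp: S_units_def)
  obtain a b where qx: "quotient_of x = (a, b)" by (cases "quotient_of x")
  obtain c d where qy: "quotient_of y = (c, d)" by (cases "quotient_of y")
  have b: "b > 0" and xe: "x = of_int a / of_int b" and d: "d > 0" and ye: "y = of_int c / of_int d"
    using quotient_of_denom_pos[OF qx] quotient_of_div[OF qx]
      quotient_of_denom_pos[OF qy] quotient_of_div[OF qy] by auto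
  have "of_int (a * c) = (of_int (b * d) :: rat)"
    using xy b d unfolding xe ye by (simp add: field_simps)
  hence ac: "a * c = b * d" by (simp only: of_int_eq_iff)
  have bp: "q = p" if "prime q" "int q dvd b" for q
    using x that qx by (auto simp: S_integers_def)
  have dp: "q = p" if "prime q" "int q dvd d" for q
    using y that qy by (auto simp: S_integers_def)
  have "\<exists>j. nat b = p ^ j"
    using b bp by (intro prime_power_if_only_prime_divisor) (auto simp flip: int_dvd_int_iff)
  then obtain j where "nat b = p ^ j" ..
  hence j: "b = int p ^ j" using b by (metis int_nat_eq less_imp_le of_nat_power)
  have a0: "a \<noteq> 0" using ac b d by auto
  have "\<exists>i. nat \<bar>a\<bar> = p ^ i"
  proof (rule prime_power_if_only_prime_divisor)
    fix q assume q: "prime q" "q dvd nat \<bar>a\<bar>"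
    hence "int q dvd a" by (simp add: dvd_nat_abs_iff)
    hence "int q dvd b * d" using ac by (metis dvd_mult2)
    hence "int q dvd b \<or> int q dvd d" using q by (simp add: prime_dvd_mult_iff)
    thus "q = p" using bp dp q by blast
  qed (use a0 in simp)
  then obtain i where "nat \<bar>a\<bar> = p ^ i" ..
  hence "int (nat \<bar>a\<bar>) = int p ^ i" by simp
  hence i: "\<bar>a\<bar> = int p ^ i" by simp
  have "\<bar>x\<bar> = of_int \<bar>a\<bar> / of_int b" using b by (simp add: xe)
  also have "\<dots> = of_nat p powi (int i - int j)"
    using prime_gt_0_nat[OF p] by (simp add: i j power_int_diff)
  finally show "\<exists>k. \<bar>x\<bar> = of_nat p powi k" ..
next
  have pos: "(of_nat p :: rat) > 0" using prime_gt_0_nat[OF p] by simp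
  have int: "z \<in> S_integers {p}" if z: "\<bar>z\<bar> = of_nat p powi k" for z :: rat and k
  proof -
    \<comment> \<open>The factor with exponent |k| clears the denominator for either sign of
      \<open>k\<close>, since k + |k| is never negative. The same fact then serves \<open>x\<close>
      and its inverse.\<close>
    have "\<bar>z\<bar> * of_nat p ^ nat \<bar>k\<bar> = of_nat p powi (k + \<bar>k\<bar>)"
      using pos z by (simp add: power_int_add flip: power_int_of_nat)
    also have "\<dots> = of_int (int p ^ nat (k + \<bar>k\<bar>))"
      by (simp add: power_int_def)
    finally have "z * of_nat p ^ nat \<bar>k\<bar> = of_int (int p ^ nat (k + \<bar>k\<bar>)) \<or>
        z * of_nat p ^ nat \<bar>k\<bar> = of_int (- (int p ^ nat (k + \<bar>k\<bar>)))"
      by (auto simp: abs_if split: if_splits)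
    thus ?thesis using S_integers_singletonI[OF p] by blast
  qed
  assume "\<exists>k. \<bar>x\<bar> = of_nat p powi k"
  then obtain k where k: "\<bar>x\<bar> = of_nat p powi k" ..
  have x0: "x \<noteq> 0" using k pos by auto
  have "\<bar>inverse x\<bar> = of_nat p powi (- k)"
    using k by (simp add: abs_inverse power_int_minus)
  thus "x \<in> S_units {p}"
    using int[OF k] int[of "inverse x"] x0 by (auto simp: S_units_def intro!: bexI[of _ "inverse x"])
qed

text \<open>A negative exponent would force |m| < 1, so m = 0, whereas a power of \<open>p\<close>
  is nonzero.\<close>

lemma of_int_S_unit_iff:
  assumes p: "prime p"
  shows "(of_int m :: rat) \<in> S_units {p} \<longleftrightarrow> (\<exists>k. \<bar>m\<bar> = int p ^ k)"
proof
  assume "(of_int m :: rat) \<in> S_units {p}"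
  then obtain k where k: "\<bar>of_int m :: rat\<bar> = of_nat p powi k"
    using S_units_singleton_iff[OF p] by blast
  have p1: "(of_nat p :: rat) > 1" using prime_gt_1_nat[OF p] by simp
  have "k \<ge> 0"
  proof (rule ccontr)
    assume "\<not> k \<ge> 0"
    hence "(of_nat p :: rat) powi k < of_nat p powi 0"
      using p1 by (intro power_int_strict_increasing) auto
    hence "\<bar>of_int m :: rat\<bar> < 1" using k by simp
    hence "m = 0" by (metis of_int_abs of_int_less_1_iff zero_less_abs_iff zabs_less_one_iff)
    thus False using k p1 by auto
  qed
  hence "of_int \<bar>m\<bar> = (of_int (int p ^ nat k) :: rat)"
    using k by (simp add: power_int_def)
  hence "\<bar>m\<bar> = int p ^ nat k" by (simp only: of_int_eq_iff)
  thus "\<exists>k. \<bar>m\<bar> = int p ^ k" ..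
next
  assume "\<exists>k. \<bar>m\<bar> = int p ^ k"
  then obtain k where "\<bar>m\<bar> = int p ^ k" ..
  hence "\<bar>of_int m :: rat\<bar> = of_nat p powi int k"
    by (metis of_int_abs of_int_of_nat_eq of_int_power power_int_of_nat)
  thus "(of_int m :: rat) \<in> S_units {p}" using S_units_singleton_iff[OF p] by blast
qed

text \<open>The additive form avoids truncated subtraction and turns the search for chords into a
  question about base-\<open>p\<close> addition.\<close>

lemma S_unit_adj_of_nat_iff:
  assumes p: "prime p" and "x \<le> y"
  shows "S_unit_adj {p} (of_nat y) (of_nat x) \<longleftrightarrow> (\<exists>k. y = x + p ^ k)"
proof -
  have "(of_nat y - of_nat x :: rat) = of_int (int (y - x))" using assms by (simp add: of_nat_diff)
  hence "S_unit_adj {p} (of_nat y) (of_nat x) \<longleftrightarrow> (\<exists>k. \<bar>int (y - x)\<bar> = int p ^ k)"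
    unfolding S_unit_adj_def using of_int_S_unit_iff[OF p] by metis
  also have "\<dots> \<longleftrightarrow> (\<exists>k. y - x = p ^ k)" by (simp flip: of_nat_power)
  also have "\<dots> \<longleftrightarrow> (\<exists>k. y = x + p ^ k)"
    using assms(2) by (intro ex_cong1) auto
  finally show ?thesis .
qed

lemma S_unit_adj_singleton_commute:
  assumes "prime p"
  shows "S_unit_adj {p} x y \<longleftrightarrow> S_unit_adj {p} y x"
  unfolding S_unit_adj_def S_units_singleton_iff[OF assms] by (simp add: abs_minus_commute)

section \<open>Minimal vanishing sums of units\<close>

text \<open>Strong induction on the number of terms. A family rather than a set of units is used
  because terms may repeat; both \<open>I\<close> and \<open>u\<close> vary in the induction, since
  merging shrinks the one and alters the other.\<close>

lemma card_minimal_zero_sum_cong: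
  fixes u :: "'a \<Rightarrow> rat"
  assumes p: "prime p" and "finite I" and "I \<noteq> {}"
    and "\<And>i. i \<in> I \<Longrightarrow> u i \<in> S_units {p}"
    and "sum u I = 0"
    and "\<And>K. K \<subseteq> I \<Longrightarrow> K \<noteq> {} \<Longrightarrow> sum u K = 0 \<Longrightarrow> K = I"
  shows "[card I = 2] (mod (p - 1))"
  using assms(2-)
proof (induction "card I" arbitrary: I u rule: less_induct)
  case less
  note fin = \<open>finite I\<close> and min = less.prems(5)
  have pos: "(of_nat p :: rat) > 0" using prime_gt_0_nat[OF p] by simp
  have "\<forall>i\<in>I. \<exists>k. \<bar>u i\<bar> = of_nat p powi k"
    using less.prems(3) S_units_singleton_iff[OF p] by blast
  then obtain e where e: "\<And>i. i \<in> I \<Longrightarrow> \<bar>u i\<bar> = of_nat p powi e i" by metis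
  \<comment> \<open>A term of least valuation; \<open>J0\<close> below collects all terms of that
    valuation.\<close>
  define i0 where "i0 = arg_min_on e I"
  have i0: "i0 \<in> I" "\<And>i. i \<in> I \<Longrightarrow> e i0 \<le> e i"
    using arg_min_if_finite(1)[OF fin less.prems(2), of e]
      arg_min_least[OF fin less.prems(2), of _ e] by (auto simp: i0_def)
  have u0: "u i0 \<noteq> 0" using e[OF i0(1)] pos by auto
  define J0 where "J0 = {i \<in> I. e i = e i0}"
  show ?case
  \<comment> \<open>Two opposite terms already vanish together, so minimality makes them the whole
    sum: this is the base of the induction. Otherwise all terms in \<open>J0\<close> equal
    \<open>u i0\<close>.\<close>
  proof (cases "\<exists>i\<in>J0. u i = - u i0")
    case True
    then obtain i where i: "i \<in> I" "u i = - u i0" by (auto simp: J0_def)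
    have "i \<noteq> i0" using i u0 by auto
    hence "{i, i0} = I" using i i0 by (intro min) auto
    hence "card I = 2" using \<open>i \<noteq> i0\<close> by (metis card_2_iff)
    thus ?thesis by simp
  next
    case False
    have J0: "u i = u i0" if "i \<in> J0" for i
    proof -
      have "\<bar>u i\<bar> = \<bar>u i0\<bar>" using that e i0 by (auto simp: J0_def)
      thus ?thesis using False that by (auto simp: abs_eq_iff)
    qed
    \<comment> \<open>Outside \<open>J0\<close> the valuation is strictly larger, so the quotient by
      \<open>u i0\<close> is an integer multiple of \<open>p\<close>; its sign is absorbed into
      \<open>w\<close>.\<close>
    have "\<exists>w. u i = u i0 * of_int (int p * w)" if i: "i \<in> I - J0" for i
    proof -
      have "e i > e i0" using i i0(2)[of i] by (auto simp: J0_def order.order_iff_strict)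
      then obtain t where t: "e i = e i0 + (1 + int t)"
        using zless_iff_Suc_zadd[of "e i0" "e i"] by auto
      have "\<bar>u i\<bar> = \<bar>u i0\<bar> * (of_nat p * of_nat p ^ t)"
        using e[of i] e[OF i0(1)] i pos by (simp add: t power_int_add)
      also have "\<dots> = \<bar>u i0 * of_int (int p * int p ^ t)\<bar>"
        by (simp add: abs_mult)
      finally show ?thesis
      proof (subst (asm) abs_eq_iff, elim disjE)
        assume "u i = - (u i0 * of_int (int p * int p ^ t))"
        thus ?thesis by (intro exI[of _ "- (int p ^ t)"]) simp
      qed blast
    qed
    then obtain w where w: "\<And>i. i \<in> I - J0 \<Longrightarrow> u i = u i0 * of_int (int p * w i)" by metis
    \<comment> \<open>Dividing the vanishing sum by \<open>u i0\<close> leaves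
      \<open>card J0\<close> plus a multiple of \<open>p\<close>, so \<open>p\<close> divides
      \<open>card J0\<close>, and \<open>p\<close> equal terms are available.\<close>
    have "0 = sum u J0 + sum u (I - J0)"
      using fin less.prems(4) sum.subset_diff[of J0 I u] by (simp add: J0_def add.commute)
    also have "\<dots> = u i0 * of_int (int (card J0) + int p * sum w (I - J0))"
      using w J0 by (simp add: distrib_left sum_distrib_left)
    finally have "(of_int (int (card J0) + int p * sum w (I - J0)) :: rat) = 0"
      using u0 by (metis mult_eq_0_iff)
    hence "int (card J0) + int p * sum w (I - J0) = 0" by (simp only: of_int_eq_0_iff)
    hence "int (card J0) = int p * - sum w (I - J0)" by simp
    hence "int p dvd int (card J0)" by (rule dvdI)
    hence "p dvd card J0" by (simp add: int_dvd_int_iff)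
    moreover have "card J0 > 0" using i0 fin by (auto simp: J0_def card_gt_0_iff)
    ultimately have "p \<le> card J0" by (rule dvd_imp_le)
    then obtain J where J: "J \<subseteq> J0" "card J = p" "finite J"
      using obtain_subset_with_card_n by blast
    then obtain j where j: "j \<in> J" using prime_gt_0_nat[OF p] by fastforce
    have JI: "J \<subseteq> I" using J by (auto simp: J0_def)
    have uj: "u j = u i0" using J j J0 by blast
    have sumJ: "sum u J = of_nat p * u j" using J J0 uj by (simp add: subset_iff)
    \<comment> \<open>The index \<open>j\<close> stays as representative of the block
      \<open>J\<close> and carries the sum of the block, which is again a unit.\<close>
    define I' where "I' = I - (J - {j})"
    define u' where "u' = u(j := of_nat p * u j)"
    have jI': "j \<in> I'" using j JI by (auto simp: I'_def)
    \<comment> \<open>Expanding \<open>j\<close> back into \<open>J\<close> preserves sums, so a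
      vanishing subsum of the merged family gives one of the original family.\<close>
    have sum': "sum u' K = sum u (J \<union> (K - {j}))" if K: "K \<subseteq> I'" "j \<in> K" for K
    proof -
      have "finite K" using K fin by (auto simp: I'_def intro: finite_subset)
      hence "sum u' K = of_nat p * u j + sum u' (K - {j})"
        using K by (simp add: sum.remove u'_def)
      also have "sum u' (K - {j}) = sum u (K - {j})" by (intro sum.cong) (auto simp: u'_def)
      also have "of_nat p * u j + \<dots> = sum u (J \<union> (K - {j}))"
        using \<open>finite K\<close> J K by (subst sum.union_disjoint) (auto simp: sumJ I'_def)
      finally show ?thesis .
    qed
    have "card I = card I' + card (J - {j})"
      using fin JI by (subst card_Un_disjoint[symmetric]) (auto simp: I'_def J intro!: arg_cong[of _ _ card])
    hence card: "card I = card I' + (p - 1)" using J j by simp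
    have "[card I' = 2] (mod (p - 1))"
    proof (rule less.hyps)
      show "card I' < card I" using card prime_gt_1_nat[OF p] by simp
      show "finite I'" "I' \<noteq> {}" using fin jI' by (auto simp: I'_def)
      show "u' i \<in> S_units {p}" if "i \<in> I'" for i
      proof (cases "i = j")
        case True
        have "\<bar>u' i\<bar> = of_nat p powi (1 + e j)"
          using True e[of j] j JI pos by (simp add: u'_def abs_mult power_int_add subset_iff)
        thus ?thesis using S_units_singleton_iff[OF p] by blast
      qed (use that less.prems(3) in \<open>auto simp: u'_def I'_def\<close>)
      have "J \<union> (I' - {j}) = I" using j JI by (auto simp: I'_def)
      thus "sum u' I' = 0" using sum'[of I'] jI' less.prems(4) by simp
      show "K = I'" if K: "K \<subseteq> I'" "K \<noteq> {}" "sum u' K = 0" for K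
      proof (cases "j \<in> K")
        case True
        hence "J \<union> (K - {j}) = I"
          using K sum'[of K] JI j by (intro min) (auto simp: I'_def)
        thus ?thesis using K True by (auto simp: I'_def)
      next
        case False
        \<comment> \<open>Without \<open>j\<close>, the set \<open>K\<close> avoids the whole block,
          so minimality of the original sum would give K = I, although \<open>j\<close> lies in
          \<open>I\<close>.\<close>
        hence "sum u' K = sum u K" by (intro sum.cong) (auto simp: u'_def)
        hence "K = I" using K by (intro min) (auto simp: I'_def)
        thus ?thesis using False j JI by auto
      qed
    qed
    thus ?thesis by (simp add: card cong_def)
  qed
qed

section \<open>Steps of a cycle and nondegeneracy\<close>

lemma sum_cycle_step:
  assumes "n \<ge> 1"
  shows "(\<Sum>i=1..n. cycle_step n a i) = 0"
proof -
  obtain m where n: "n = Suc m" using assms by (cases n) auto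
  have "(\<Sum>i=1..n. cycle_step n a i) = (\<Sum>i=1..m. cycle_step n a i) + (a 1 - a n)"
    by (simp add: n cycle_step_def)
  also have "(\<Sum>i=1..m. cycle_step n a i) = (\<Sum>i=1..m. a (Suc i) - a i)"
    by (intro sum.cong) (auto simp: n cycle_step_def)
  also have "\<dots> = a n - a 1" by (simp add: sum_Suc_diff n)
  finally show ?thesis by simp
qed

text \<open>Only the closing step can be negative, so a vanishing subsum must contain it. As all
  steps together sum to zero, the complementary steps vanish too; but they are all positive, and
  there is at least one.\<close>

lemma not_degenerate_cycle_if_increasing:
  assumes inc: "\<And>i. 1 \<le> i \<Longrightarrow> i < n \<Longrightarrow> a i < a (i + 1)"
  shows "\<not> degenerate_cycle n a"
proof
  assume "degenerate_cycle n a"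
  then obtain I where I: "I \<subseteq> {1..n}" "0 < card I" "card I < n"
    and s: "(\<Sum>i\<in>I. cycle_step n a i) = 0"
    by (auto simp: degenerate_cycle_def)
  have pos: "(\<Sum>i\<in>K. cycle_step n a i) > 0" if "K \<subseteq> {1..n}" "n \<notin> K" "K \<noteq> {}" for K
    using that inc finite_subset[OF that(1)]
    by (intro sum_pos) (auto simp: cycle_step_def subset_iff le_eq_less_or_eq)
  show False
  proof (cases "n \<in> I")
    case True
    have "(\<Sum>i\<in>{1..n} - I. cycle_step n a i) = 0"
      using I s sum_cycle_step[of n a] sum.subset_diff[of I "{1..n}" "cycle_step n a"] by simp
    moreover have "{1..n} - I \<noteq> {}"
      using I by (metis Diff_eq_empty_iff card_atLeastAtMost diff_Suc_1 nat_less_le subset_antisym)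
    ultimately show False using pos[of "{1..n} - I"] True by simp
  next
    case False
    thus ?thesis using pos[of I] I s by fastforce
  qed
qed

section \<open>Numbers with a single nonzero base-\<open>p\<close> digit\<close>

text \<open>Enumerates these numbers in increasing order from index 0: the quotient of
  \<open>m\<close> by p - 1 is the position of the digit, and the remainder plus one is the
  digit.\<close>

definition one_digit :: "nat \<Rightarrow> nat \<Rightarrow> nat" where
  "one_digit p m = (m mod (p - 1) + 1) * p ^ (m div (p - 1))"

context
  fixes p :: nat
  assumes p_gt_1: "p > 1"
begin

text \<open>Below digit p - 1 the digit grows by one. At digit p - 1 a carry produces the first
  number of the next block, and the difference is still the old power of \<open>p\<close>.\<close>

lemma one_digit_Suc: "one_digit p (Suc m) = one_digit p m + p ^ (m div (p - 1))"
proof (cases "Suc (m mod (p - 1)) = p - 1")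
  case True
  hence "Suc m mod (p - 1) = 0" "Suc m div (p - 1) = Suc (m div (p - 1))"
    by (simp_all only: mod_Suc div_Suc if_True refl)
  hence "one_digit p (Suc m) = p * p ^ (m div (p - 1))"
    by (simp add: one_digit_def)
  also have "p = m mod (p - 1) + 1 + 1" using True p_gt_1 by linarith
  hence "p * p ^ (m div (p - 1)) = (m mod (p - 1) + 1 + 1) * p ^ (m div (p - 1))" by simp
  finally show ?thesis by (simp add: one_digit_def)
next
  case False
  thus ?thesis by (simp add: one_digit_def mod_Suc div_Suc)
qed

lemma strict_mono_one_digit: "strict_mono (one_digit p)"
  using p_gt_1 by (simp add: strict_mono_Suc_iff one_digit_Suc)

text \<open>This excludes chords among the one-digit numbers: adding a power of \<open>p\<close> at
  a position other than that of the digit leaves two nonzero digits.\<close>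

lemma one_digit_add_power:
  assumes eq: "one_digit p m' = one_digit p m + p ^ j"
  shows "m' = Suc m"
proof -
  define c q d r where "c = m mod (p - 1) + 1" and "q = m div (p - 1)"
    and "d = m' mod (p - 1) + 1" and "r = m' div (p - 1)"
  have "m mod (p - 1) < p - 1" "m' mod (p - 1) < p - 1" using p_gt_1 by auto
  hence c: "0 < c" "c < p" and d: "0 < d" "d < p" unfolding c_def d_def by linarith+
  have eq': "d * p ^ r = c * p ^ q + p ^ j"
    using eq by (simp add: one_digit_def c_def q_def d_def r_def)
  \<comment> \<open>The right-hand side has lowest nonzero digit \<open>x\<close> at position
    \<open>s\<close> and something nonzero above it. If r <= s, cancelling makes \<open>d\<close> at
    least \<open>p\<close>; if r > s, cancelling makes \<open>p\<close> divide
    \<open>x\<close>.\<close>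
  have no_digit: False if "d * p ^ r = (x + y * p ^ Suc t) * p ^ s" "0 < x" "x < p" "y > 0" for x y s t
  proof -
    consider "r \<le> s" | "s < r" by linarith
    thus False
    proof cases
      case 1
      then obtain k where "s = r + k" using le_Suc_ex by blast
      hence "d = (x + y * p ^ Suc t) * p ^ k" using that p_gt_1 by (simp add: power_add)
      moreover have "p \<le> (x + y * p ^ Suc t) * p ^ k"
      proof -
        have "p * 1 \<le> p * (y * p ^ t * p ^ k)" using that(4) p_gt_1 by (intro mult_le_mono2) simp
        also have "\<dots> \<le> (x + y * p ^ Suc t) * p ^ k" by (simp add: algebra_simps)
        finally show ?thesis by simp
      qed
      ultimately show False using d by simp
    next
      case 2
      then obtain k where "r = s + Suc k" using less_imp_Suc_add by (metis add_Suc_right)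
      hence "d * p ^ Suc k = x + y * p ^ Suc t" using that p_gt_1 by (simp add: power_add)
      hence "p * (d * p ^ k) = x + p * (y * p ^ t)" by (simp add: mult_ac)
      hence "p dvd x" by (metis dvd_add_times_triv_right_iff dvd_triv_left mult.commute)
      thus False using that by (auto dest: dvd_imp_le)
    qed
  qed
  consider "j = q" | "j < q" | "q < j" by linarith
  thus ?thesis
  proof cases
    case 1
    hence "one_digit p m' = one_digit p (Suc m)" using eq by (simp add: one_digit_Suc q_def)
    thus ?thesis using strict_mono_one_digit by (simp add: strict_mono_eq)
  next
    case 2
    then obtain t where "q = j + Suc t" using less_imp_Suc_add by (metis add_Suc_right)
    hence "d * p ^ r = (1 + c * p ^ Suc t) * p ^ j" using eq' by (simp add: power_add algebra_simps)
    thus ?thesis using no_digit[of 1 c t j] c p_gt_1 by simp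
  next
    case 3
    then obtain t where "j = q + Suc t" using less_imp_Suc_add by (metis add_Suc_right)
    hence "d * p ^ r = (c + 1 * p ^ Suc t) * p ^ q" using eq' by (simp add: power_add algebra_simps)
    thus ?thesis using no_digit[of c 1 t q] c by simp
  qed
qed

lemma one_digit_0: "one_digit p 0 = 1"
  by (simp add: one_digit_def)

lemma one_digit_mult: "one_digit p (k * (p - 1)) = p ^ k"
  using p_gt_1 by (simp add: one_digit_def)

text \<open>This finds the neighbours of the last vertex p^k + 1. For j = 0 the other vertex is p^k.
  For j > 0 it is congruent to 1 modulo \<open>p\<close>, which rules out the blocks after the first
  and leaves only the number 1 in the first.\<close>

lemma power_Suc_eq_one_digit_add:
  assumes eq: "p ^ k + 1 = one_digit p m + p ^ j" and k: "k > 0" and m: "m \<le> k * (p - 1)"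
  shows "m = 0 \<or> m = k * (p - 1)"
proof (cases "j = 0")
  case True
  hence "one_digit p m = one_digit p (k * (p - 1))" using eq by (simp add: one_digit_mult del: One_nat_def)
  thus ?thesis using strict_mono_one_digit by (simp add: strict_mono_eq)
next
  case False
  hence pj: "p dvd p ^ j" and pk: "p dvd p ^ k" using k by auto
  have "m mod (p - 1) < p - 1" using p_gt_1 by auto
  show ?thesis
  proof (cases "m div (p - 1) = 0")
    case True
    hence "one_digit p m = m + 1" and "m < p" using p_gt_1 by (auto simp: one_digit_def div_eq_0_iff)
    hence "p ^ k = m + p ^ j" using eq by simp
    hence "p dvd m" using pj pk by (metis dvd_add_left_iff)
    hence "m = 0" using \<open>m < p\<close> by (auto dest: dvd_imp_le)
    thus ?thesis ..
  next
    case nz: False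
    hence "p dvd one_digit p m" by (simp add: one_digit_def)
    hence "p dvd p ^ k + 1" using pj eq by simp
    hence "p dvd 1" using pk dvd_add_right_iff by blast
    thus ?thesis using p_gt_1 by simp
  qed
qed

end

section \<open>The cycle of length k (p - 1) + 2\<close>

lemma exists_nondegenerate_induced_cycle:
  assumes p: "prime p" and k: "k > 0" and n: "n = k * (p - 1) + 2"
  shows "\<exists>a. is_induced_cycle {p} n a \<and> \<not> degenerate_cycle n a"
proof -
  have p1: "p > 1" using prime_gt_1_nat[OF p] .
  have n3: "n \<ge> 3" using n k p1 by simp
  \<comment> \<open>Vertices count from 1 and \<open>one_digit\<close> from 0, hence the shift.
    Vertex n - 1 is p^k, so the last vertex is joined to it by 1 = p^0 and to the first vertex by
    p^k.\<close>
  define b where "b i = (if i = n then p ^ k + 1 else one_digit p (i - 1))" for i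
  define a :: "nat \<Rightarrow> rat" where "a i = of_nat (b i)" for i
  note mono = strict_mono_one_digit[OF p1]
  have bn1: "b (n - 1) = p ^ k" using n n3 by (simp add: b_def one_digit_mult[OF p1] del: One_nat_def)
  have less: "b i < b j" if "1 \<le> i" "i < j" "j \<le> n" for i j
  proof (cases "j = n")
    case True
    have "one_digit p (i - 1) \<le> one_digit p (k * (p - 1))"
      using that n by (intro monoD[OF strict_mono_mono[OF mono]]) auto
    thus ?thesis using that True by (simp add: b_def one_digit_mult[OF p1] del: One_nat_def)
  next
    case False
    thus ?thesis using that mono by (simp add: b_def strict_mono_less)
  qed
  \<comment> \<open>Restricting to i < j makes the difference positive; the other order follows from
    symmetry of adjacency.\<close>
  have adj: "S_unit_adj {p} (a j) (a i) \<longleftrightarrow> j = i + 1 \<or> (i = 1 \<and> j = n)"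
    if ij: "1 \<le> i" "i < j" "j \<le> n" for i j
  proof -
    have "S_unit_adj {p} (a j) (a i) \<longleftrightarrow> (\<exists>l. b j = b i + p ^ l)"
      unfolding a_def using less[OF ij] by (intro S_unit_adj_of_nat_iff[OF p]) simp
    also have "\<dots> \<longleftrightarrow> j = i + 1 \<or> (i = 1 \<and> j = n)"
    proof (cases "j = n")
      case True
      show ?thesis
      proof
        assume "\<exists>l. b j = b i + p ^ l"
        then obtain l where "p ^ k + 1 = one_digit p (i - 1) + p ^ l"
          using True ij by (auto simp: b_def)
        hence "i - 1 = 0 \<or> i - 1 = k * (p - 1)"
          using k ij n by (intro power_Suc_eq_one_digit_add[OF p1]) auto
        thus "j = i + 1 \<or> (i = 1 \<and> j = n)" using True n ij by auto
      next
        assume "j = i + 1 \<or> (i = 1 \<and> j = n)"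
        thus "\<exists>l. b j = b i + p ^ l"
        proof
          assume "j = i + 1"
          hence "b j = b i + p ^ 0" using True bn1 by (auto simp: b_def)
          thus ?thesis ..
        next
          assume "i = 1 \<and> j = n"
          hence "b j = b i + p ^ k" using n3 by (simp add: b_def one_digit_0[OF p1])
          thus ?thesis ..
        qed
      qed
    next
      case False
      have "j - 1 = Suc (i - 1) \<longleftrightarrow> j = i + 1" using ij by auto
      moreover have "b j = one_digit p (j - 1)" "b i = one_digit p (i - 1)"
        using ij False by (auto simp: b_def)
      ultimately show ?thesis
        using one_digit_add_power[OF p1, of "j - 1" "i - 1"] one_digit_Suc[OF p1, of "i - 1"] False
        by metis
    qed
    finally show ?thesis .
  qed
  have inj: "inj_on a {1..n}"
  proof (rule inj_onI)
    fix i j assume "i \<in> {1..n}" "j \<in> {1..n}" "a i = a j"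
    thus "i = j" using less[of i j] less[of j i] by (cases i j rule: linorder_cases) (auto simp: a_def)
  qed
  have "S_unit_adj {p} (a j) (a i) \<longleftrightarrow> j = i + 1 \<or> i = j + 1 \<or> {i, j} = {1, n}"
    if "i \<in> {1..n}" "j \<in> {1..n}" "i \<noteq> j" for i j
    using adj[of i j] adj[of j i] S_unit_adj_singleton_commute[OF p, of "a i" "a j"] that n3
    by (cases i j rule: linorder_cases) (auto simp: doubleton_eq_iff)
  moreover have "is_cycle {p} n a"
    using n3 inj adj S_unit_adj_singleton_commute[OF p, of "a 1" "a n"] by (auto simp: is_cycle_def)
  ultimately have "is_induced_cycle {p} n a" by (simp add: is_induced_cycle_def)
  moreover have "\<not> degenerate_cycle n a"
    by (rule not_degenerate_cycle_if_increasing) (use less in \<open>simp add: a_def\<close>)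
  ultimately show ?thesis by blast
qed

section \<open>The congruence for the length, and the equivalence\<close>

lemma nondegenerate_cycle_length_cong:
  assumes p: "prime p" and cyc: "is_cycle {p} n a" and nondeg: "\<not> degenerate_cycle n a"
  shows "[n = 2] (mod (p - 1))"
proof -
  have n: "n \<ge> 3" using cyc by (simp add: is_cycle_def)
  have "[card {1..n} = 2] (mod (p - 1))"
  proof (rule card_minimal_zero_sum_cong[OF p, where u = "cycle_step n a"])
    show "cycle_step n a i \<in> S_units {p}" if "i \<in> {1..n}" for i
      using that cyc by (auto simp: is_cycle_def cycle_step_def S_unit_adj_def)
    show "sum (cycle_step n a) {1..n} = 0" using sum_cycle_step n by simp
    show "K = {1..n}" if K: "K \<subseteq> {1..n}" "K \<noteq> {}" "sum (cycle_step n a) K = 0" for K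
    proof (rule ccontr)
      \<comment> \<open>A proper nonempty \<open>K\<close> would have cardinality strictly between 0
        and \<open>n\<close> and so witness degeneracy.\<close>
      assume "K \<noteq> {1..n}"
      hence "card K < card {1..n}" using K by (intro psubset_card_mono) auto
      moreover have "card K > 0" using K by (auto simp: card_gt_0_iff intro: finite_subset)
      ultimately show False using nondeg K by (auto simp: degenerate_cycle_def)
    qed
  qed (use n in auto)
  thus ?thesis by simp
qed

theorem theorem1p2:
  fixes p n :: nat
  assumes "prime p" and "n \<ge> 3"
  shows "(\<exists>a :: nat \<Rightarrow> rat. is_induced_cycle {p} n a \<and> \<not> degenerate_cycle n a)
           \<longleftrightarrow> [n = 2] (mod (p - 1))"
proof
  assume "\<exists>a. is_induced_cycle {p} n a \<and> \<not> degenerate_cycle n a"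
  thus "[n = 2] (mod (p - 1))"
    using nondegenerate_cycle_length_cong[OF assms(1)] by (auto simp: is_induced_cycle_def)
next
  assume "[n = 2] (mod (p - 1))"
  hence "p - 1 dvd n - 2" using assms(2) by (simp add: cong_altdef_nat)
  then obtain k where "n - 2 = k * (p - 1)" by (metis dvd_def mult.commute)
  hence k: "n = k * (p - 1) + 2" using assms(2) by simp
  \<comment> \<open>For k = 0 the length would be 2.\<close>
  moreover have "k > 0" using k assms(2) by (cases k) auto
  ultimately show "\<exists>a. is_induced_cycle {p} n a \<and> \<not> degenerate_cycle n a"
    using exists_nondegenerate_induced_cycle[OF assms(1)] by blast
qed

end
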